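(* Let $H$ be a graph on $k\geq 1$ edges with maximum degree $\Delta$. Then $$AR_s(H) \geq \frac{(k-1)^2}{2\Delta}.$$ Moreover, if $H$ has chromatic index $\chi'(H) = \Delta$, then $$AR_s(H) \geq \frac{k(k+1)}{2\Delta}.$$
   Context: All graphs are finite and simple. An edge-coloring is proper if adjacent edges receive distinct colors; the chromatic index $\chi'(H)$ is the smallest number of colors in a proper edge-coloring of $H$. An edge-colored graph is rainbow if all its edges have distinct colors. A copy of $H$ is a (not necessarily induced) subgraph isomorphic to $H$. $AR_s(H)$ is the smallest number of edges in a graph $G$ such that every proper edge-coloring of $G$ contains a rainbow copy of $H$. *)

theory Defs
  imports Complex_Main
begin

definition simple_graph :: "'a set \<Rightarrow> 'a set set \<Rightarrow> bool" where
  "simple_graph V E \<longleftrightarrow> finite V \<and> (\<forall>e\<in>E. e \<subseteq> V \<and> card e = 2)"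

definition degree :: "'a set set \<Rightarrow> 'a \<Rightarrow> nat" where
  "degree E v = card {e \<in> E. v \<in> e}"

definition max_degree :: "'a set \<Rightarrow> 'a set set \<Rightarrow> nat" where
  "max_degree V E = Max (degree E ` V)"

definition proper_edge_coloring :: "'a set set \<Rightarrow> ('a set \<Rightarrow> 'c) \<Rightarrow> bool" where
  "proper_edge_coloring E c \<longleftrightarrow>
     (\<forall>e\<in>E. \<forall>f\<in>E. e \<noteq> f \<and> e \<inter> f \<noteq> {} \<longrightarrow> c e \<noteq> c f)"

definition rainbow :: "'a set set \<Rightarrow> ('a set \<Rightarrow> 'c) \<Rightarrow> bool" where
  "rainbow E c \<longleftrightarrow> inj_on c E"

(* Taking colors in nat is no restriction: only the finitely many colors of edges matter. *)
definition chromatic_index :: "'a set set \<Rightarrow> nat" where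
  "chromatic_index E =
     (LEAST n. \<exists>c :: 'a set \<Rightarrow> nat. proper_edge_coloring E c \<and> card (c ` E) = n)"

definition subgraph :: "'a set \<Rightarrow> 'a set set \<Rightarrow> 'a set \<Rightarrow> 'a set set \<Rightarrow> bool" where
  "subgraph W F V E \<longleftrightarrow> simple_graph W F \<and> W \<subseteq> V \<and> F \<subseteq> E"

definition isomorphic :: "'a set \<Rightarrow> 'a set set \<Rightarrow> 'b set \<Rightarrow> 'b set set \<Rightarrow> bool" where
  "isomorphic V E W F \<longleftrightarrow>
     (\<exists>\<phi>. bij_betw \<phi> V W \<and> (\<forall>u\<in>V. \<forall>v\<in>V. {u, v} \<in> E \<longleftrightarrow> {\<phi> u, \<phi> v} \<in> F))"

definition forces_rainbow ::
    "'b set \<Rightarrow> 'b set set \<Rightarrow> 'a set \<Rightarrow> 'a set set \<Rightarrow> bool" where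
  "forces_rainbow VG EG VH EH \<longleftrightarrow>
     (\<forall>c :: 'b set \<Rightarrow> nat. proper_edge_coloring EG c \<longrightarrow>
        (\<exists>W F. subgraph W F VG EG \<and> isomorphic VH EH W F \<and> rainbow F c))"

(* Every finite graph is isomorphic to one with vertices in nat, so G ranges over those.
   The minimum exists: for any finite H, every sufficiently large complete graph forces a
   rainbow copy of H (embed the vertices of H greedily). *)
definition AR_s :: "'a set \<Rightarrow> 'a set set \<Rightarrow> nat" where
  "AR_s VH EH =
     (LEAST m. \<exists>(VG :: nat set) EG.
        simple_graph VG EG \<and> card EG = m \<and> forces_rainbow VG EG VH EH)"

end

theory Submission
  imports Defs "HOL-Combinatorics.Transposition"
begin

text \<open>
  Let \<open>G\<close> force a rainbow copy of \<open>H\<close>. Color a part \<open>U\<close> of \<open>G\<close> with \<open>r\<close> colors and give every other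
  edge a color of its own: a rainbow copy of \<open>H\<close> uses at most \<open>r\<close> edges of \<open>U\<close>, so it has at least
  \<open>k - r\<close> edges outside \<open>U\<close>. These enlarge \<open>U\<close>, and the step is repeated.

  For the first bound, all copies found are added to \<open>U\<close>. After \<open>i\<close> steps \<open>U\<close> has maximum degree at
  most \<open>i\<Delta>\<close>, hence by Vizing's theorem is colorable with \<open>i\<Delta> + 1\<close> colors, and \<open>G\<close> has at least
  \<open>(k - 1) + (k - 1 - \<Delta>) + (k - 1 - 2\<Delta>) + \<dots>\<close> edges. For the second bound only a largest color class
  of the new edges, in a coloring of \<open>H\<close> with \<open>\<Delta>\<close> colors, is added. After \<open>i\<close> steps \<open>U\<close> is a union of
  \<open>i\<close> matchings, hence \<open>i\<close>-colorable, and the next step adds at least \<open>(k - i) / \<Delta>\<close> edges.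

  Vizing's theorem is proved with fans and Kempe changes.
\<close>

section \<open>Vizing's theorem\<close>

definition free :: "'a set set \<Rightarrow> ('a set \<Rightarrow> 'c) \<Rightarrow> 'a \<Rightarrow> 'c \<Rightarrow> bool" where
  "free E c v a \<longleftrightarrow> (\<forall>e\<in>E. v \<in> e \<longrightarrow> c e \<noteq> a)"

lemma proper_edge_coloringD:
  assumes "proper_edge_coloring E c" "e \<in> E" "f \<in> E" "e \<noteq> f" "v \<in> e" "v \<in> f"
  shows "c e \<noteq> c f"
  using assms unfolding proper_edge_coloring_def by (meson disjoint_iff)

lemma exists_free_color:
  assumes "finite E" "degree E v \<le> d"
  shows "\<exists>a\<le>d. free E c v a"
proof (rule ccontr)
  assume "\<not> ?thesis"
  then have "{..d} \<subseteq> c ` {e \<in> E. v \<in> e}"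
    by (fastforce simp: free_def)
  then have "card {..d} \<le> card {e \<in> E. v \<in> e}"
    using assms(1) by (intro surj_card_le) auto
  then show False
    using assms(2) by (simp add: degree_def)
qed

section \<open>Paths alternating between two colors\<close>

primrec alternating_walk :: "('a \<Rightarrow> 'a) \<Rightarrow> ('a \<Rightarrow> 'a) \<Rightarrow> 'a \<Rightarrow> nat \<Rightarrow> 'a" where
  "alternating_walk f g x 0 = x"
| "alternating_walk f g x (Suc n) = (if even n then g else f) (alternating_walk f g x n)"

text \<open>When \<open>f\<close> and \<open>g\<close> are the partner maps of two colors, this is
  the vertex set of the component of \<open>x\<close> in the subgraph formed by the edges of these
  colors.\<close>

inductive_set orbit2 :: "('a \<Rightarrow> 'a) \<Rightarrow> ('a \<Rightarrow> 'a) \<Rightarrow> 'a \<Rightarrow> 'a set"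
  for f g x where
    base: "x \<in> orbit2 f g x"
  | left: "y \<in> orbit2 f g x \<Longrightarrow> f y \<in> orbit2 f g x"
  | right: "y \<in> orbit2 f g x \<Longrightarrow> g y \<in> orbit2 f g x"

lemma orbit2_subset:
  assumes "x \<in> S" "\<And>y. y \<in> S \<Longrightarrow> f y \<in> S" "\<And>y. y \<in> S \<Longrightarrow> g y \<in> S"
  shows "orbit2 f g x \<subseteq> S"
proof
  fix y assume "y \<in> orbit2 f g x"
  then show "y \<in> S" by induction (use assms in auto)
qed

text \<open>A component in two colors is a path or a cycle. Since \<open>f\<close> fixes
  \<open>x\<close>, it is a path starting at \<open>x\<close>, which has at most one other end. The
  walk from \<open>x\<close> begins with \<open>g\<close> because \<open>f\<close> would stand
  still; after the first end other than \<open>x\<close> it only turns back, so the vertices seen up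
  to that point are the whole orbit.\<close>

lemma orbit2_unique_end:
  assumes f: "\<And>v. f (f v) = v" and g: "\<And>v. g (g v) = v" and x: "f x = x"
    and y: "y \<in> orbit2 f g x" "y \<noteq> x" "f y = y \<or> g y = y"
    and z: "z \<in> orbit2 f g x" "z \<noteq> x" "f z = z \<or> g z = z"
  shows "y = z"
proof -
  let ?w = "alternating_walk f g x"
  \<comment> \<open>For \<open>n = 0\<close> the truncated \<open>n - 1\<close> is \<open>0\<close>,
    which is correct because \<open>f x = x\<close>.\<close>
  have fw: "f (?w n) = (if even n then ?w (n - 1) else ?w (Suc n))" for n
    by (cases n) (auto simp: f x)
  have gw: "g (?w n) = (if even n then ?w (Suc n) else ?w (n - 1))" for n
    by (cases n) (auto simp: g)
  have "orbit2 f g x \<subseteq> range ?w"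
  proof (rule orbit2_subset)
    show "x \<in> range ?w" by (rule range_eqI[of _ _ 0]) simp
  next
    fix v assume "v \<in> range ?w" then show "f v \<in> range ?w" by (auto simp: fw simp del: alternating_walk.simps)
  next
    fix v assume "v \<in> range ?w" then show "g v \<in> range ?w" by (auto simp: gw simp del: alternating_walk.simps)
  qed
  then obtain m where m: "y = ?w m" using y(1) by auto
  define is_end where "is_end n \<longleftrightarrow> ?w n \<noteq> x \<and> (f (?w n) = ?w n \<or> g (?w n) = ?w n)" for n
  define n where "n = (LEAST n. is_end n)"
  have "is_end m" using y m by (auto simp: is_end_def)
  then have n: "is_end n" unfolding n_def by (rule LeastI)
  have least: "n \<le> i" if "is_end i" for i using that unfolding n_def by (rule Least_le)
  have n0: "n > 0" using n by (cases n) (auto simp: is_end_def)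
  have n_pred: "?w (n - 1) \<noteq> ?w n"
  proof
    assume eq: "?w (n - 1) = ?w n"
    have "is_end (n - 1)" using n unfolding is_end_def eq .
    then show False using least[of "n - 1"] n0 by simp
  qed
  \<comment> \<open>One of \<open>f\<close>, \<open>g\<close> leads back to the different vertex
    \<open>?w (n - 1)\<close>, so the map that fixes \<open>?w n\<close> is the other one, which
    makes the next step.\<close>
  then have n_Suc: "?w (Suc n) = ?w n"
    using n unfolding is_end_def fw gw by (metis (full_types))
  have "orbit2 f g x \<subseteq> ?w ` {..n}"
  proof (rule orbit2_subset)
    show "x \<in> ?w ` {..n}" by (rule image_eqI[of _ _ 0]) auto
  next
    have Suc_in: "?w (Suc i) \<in> ?w ` {..n}" if "i \<le> n" for i
      using that n_Suc by (cases "i = n") (force simp del: alternating_walk.simps)+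
    have pred_in: "?w (i - 1) \<in> ?w ` {..n}" if "i \<le> n" for i
      using that by (auto simp del: alternating_walk.simps)
    fix v assume "v \<in> ?w ` {..n}"
    then obtain i where i: "i \<le> n" "v = ?w i" by auto
    show "f v \<in> ?w ` {..n}" using Suc_in[OF i(1)] pred_in[OF i(1)] unfolding i(2) fw by (simp del: alternating_walk.simps)
    show "g v \<in> ?w ` {..n}" using Suc_in[OF i(1)] pred_in[OF i(1)] unfolding i(2) gw by (simp del: alternating_walk.simps)
  qed
  then have unique: "v = ?w n" if v: "v \<in> orbit2 f g x" "v \<noteq> x" "f v = v \<or> g v = v" for v
  proof -
    obtain i where i: "i \<le> n" "v = ?w i" using v(1) \<open>orbit2 f g x \<subseteq> ?w ` {..n}\<close> by auto
    then have "is_end i" using v by (simp add: is_end_def)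
    then show ?thesis using least[of i] i by simp
  qed
  show ?thesis using unique[OF y] unique[OF z] by simp
qed

text \<open>Fixing the vertices at which the color \<open>a\<close> is free makes this a total involution.\<close>

definition partner :: "'a set set \<Rightarrow> ('a set \<Rightarrow> 'c) \<Rightarrow> 'c \<Rightarrow> 'a \<Rightarrow> 'a" where
  "partner E c a v =
     (if \<exists>w. {v, w} \<in> E \<and> c {v, w} = a then THE w. {v, w} \<in> E \<and> c {v, w} = a else v)"

lemma partner_eq:
  assumes "proper_edge_coloring E c" "{v, w} \<in> E" "c {v, w} = a"
  shows "partner E c a v = w"
proof -
  have "(THE w. {v, w} \<in> E \<and> c {v, w} = a) = w"
  proof (rule the_equality)
    fix u assume u: "{v, u} \<in> E \<and> c {v, u} = a"
    then have "{v, u} = {v, w}"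
      using proper_edge_coloringD[OF assms(1), of "{v, u}" "{v, w}" v] assms(2,3) by auto
    then show "u = w" by (auto simp: doubleton_eq_iff)
  qed (use assms in auto)
  then show ?thesis using assms(2,3) by (auto simp: partner_def)
qed

lemma partner_free:
  assumes "free E c v a"
  shows "partner E c a v = v"
  using assms by (auto simp: partner_def free_def)

lemma partner_partner:
  assumes "proper_edge_coloring E c"
  shows "partner E c a (partner E c a v) = v"
proof (cases "\<exists>w. {v, w} \<in> E \<and> c {v, w} = a")
  case True
  then obtain w where w: "{v, w} \<in> E" "c {v, w} = a" by blast
  then have "partner E c a v = w" "partner E c a w = v"
    using partner_eq[OF assms] by (auto simp: insert_commute)
  then show ?thesis by simp
qed (auto simp: partner_def)

section \<open>Kempe changes and fan rotation\<close>

definition kempe_swap :: "'c \<Rightarrow> 'c \<Rightarrow> 'a set \<Rightarrow> ('a set \<Rightarrow> 'c) \<Rightarrow> 'a set \<Rightarrow> 'c" where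
  "kempe_swap a b K c e = (if e \<inter> K = {} then c e else transpose a b (c e))"

text \<open>Edges of other colors may cross the boundary of \<open>K\<close>, but the transposition
  does not change them. Hence either endpoint of an edge decides how it is recolored.\<close>

lemma kempe_swap_at:
  assumes "\<And>e. e \<in> E \<Longrightarrow> c e \<in> {a, b} \<Longrightarrow> e \<inter> K \<noteq> {} \<Longrightarrow> e \<subseteq> K"
    and "e \<in> E" "v \<in> e"
  shows "kempe_swap a b K c e = (if v \<in> K then transpose a b (c e) else c e)"
proof (cases "c e \<in> {a, b}")
  case True
  then show ?thesis using assms by (auto simp: kempe_swap_def)
next
  case False
  then show ?thesis by (simp add: kempe_swap_def)
qed

text \<open>At a common vertex both edges are recolored by the same injective map.\<close>

lemma kempe_swap_proper:
  assumes "\<And>e. e \<in> E \<Longrightarrow> c e \<in> {a, b} \<Longrightarrow> e \<inter> K \<noteq> {} \<Longrightarrow> e \<subseteq> K"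
    and "proper_edge_coloring E c"
  shows "proper_edge_coloring E (kempe_swap a b K c)"
  unfolding proper_edge_coloring_def
proof (intro ballI impI)
  fix e f assume ef: "e \<in> E" "f \<in> E" "e \<noteq> f \<and> e \<inter> f \<noteq> {}"
  then obtain v where v: "v \<in> e" "v \<in> f" by blast
  have "c e \<noteq> c f" using assms(2) ef by (auto simp: proper_edge_coloring_def)
  then show "kempe_swap a b K c e \<noteq> kempe_swap a b K c f"
    using kempe_swap_at[of E c a b K, OF assms(1)] ef v by (simp add: bij_is_inj[THEN inj_eq])
qed

lemma kempe_swap_free:
  assumes "\<And>e. e \<in> E \<Longrightarrow> c e \<in> {a, b} \<Longrightarrow> e \<inter> K \<noteq> {} \<Longrightarrow> e \<subseteq> K"
  shows "free E (kempe_swap a b K c) v r \<longleftrightarrow>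
    free E c v (if v \<in> K then transpose a b r else r)"
proof -
  have "kempe_swap a b K c e = r \<longleftrightarrow> c e = (if v \<in> K then transpose a b r else r)"
    if "e \<in> E" "v \<in> e" for e
    using kempe_swap_at[of E c a b K, OF assms that] by (metis transpose_involutory)
  then show ?thesis by (auto simp: free_def)
qed

text \<open>The uncolored edge is moved along the fan: \<open>{x, y}\<close> takes the color of
  \<open>{x, z}\<close> for the next fan vertex \<open>z\<close>, which is free at \<open>y\<close>,
  and \<open>{x, z}\<close> becomes the uncolored edge. When it has reached the last vertex,
  \<open>b\<close> is free at both of its ends.\<close>

lemma fan_rotation:
  assumes "proper_edge_coloring (E - {{x, y}}) c" "c ` (E - {{x, y}}) \<subseteq> D"
    and "\<And>u. u \<in> set (y # ys) \<Longrightarrow> {x, u} \<in> E" "x \<notin> set (y # ys)" "distinct (y # ys)"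
    and "successively (\<lambda>u v. free (E - {{x, y}}) c u (c {x, v})) (y # ys)"
    and "free (E - {{x, y}}) c x b" "free (E - {{x, y}}) c (last (y # ys)) b" "b \<in> D"
  shows "\<exists>c'. proper_edge_coloring E c' \<and> c' ` E \<subseteq> D"
  using assms
proof (induction ys arbitrary: y c)
  case Nil
  let ?c = "c({x, y} := b)"
  have "proper_edge_coloring E ?c"
    using Nil.prems(1,7,8) unfolding proper_edge_coloring_def free_def by auto
  moreover have "?c ` E \<subseteq> D" using Nil.prems(2,9) by auto
  ultimately show ?case by blast
next
  case (Cons z zs)
  let ?c = "c({x, y} := c {x, z})"
  have xz: "{x, z} \<in> E - {{x, y}}"
    using Cons.prems(3,5) by (auto simp: doubleton_eq_iff)
  have yz: "free (E - {{x, y}}) c y (c {x, z})"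
    using Cons.prems(6) by simp
  \<comment> \<open>The only newly colored edge is \<open>{x, y}\<close>, and uncoloring
    \<open>{x, z}\<close> can only free colors.\<close>
  have free_mono: "free (E - {{x, z}}) ?c u r"
    if "free (E - {{x, y}}) c u r" "u \<noteq> x" "u \<noteq> y" for u r
    using that unfolding free_def by auto
  show ?case
  proof (rule Cons.IH[of z ?c])
    \<comment> \<open>A conflict at \<open>y\<close> is excluded because the color is free there, a
      conflict at \<open>x\<close> because \<open>{x, z}\<close> had this color.\<close>
    have "c {x, z} \<noteq> c f" if "f \<in> E - {{x, z}}" "f \<noteq> {x, y}" "{x, y} \<inter> f \<noteq> {}" for f
    proof (cases "y \<in> f")
      case True
      then show ?thesis using yz that unfolding free_def by auto
    next
      case False
      then have "x \<in> f" using that by auto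
      then show ?thesis
        using that xz by (intro proper_edge_coloringD[OF Cons.prems(1), of _ _ x]) auto
    qed
    then have new: "?c {x, y} \<noteq> ?c f"
      if "f \<in> E - {{x, z}}" "f \<noteq> {x, y}" "{x, y} \<inter> f \<noteq> {}" for f
      using that by simp
    have old: "?c e \<noteq> ?c f"
      if "e \<in> E" "f \<in> E" "e \<noteq> {x, y}" "f \<noteq> {x, y}" "e \<noteq> f" "e \<inter> f \<noteq> {}" for e f
      using that Cons.prems(1) by (simp add: proper_edge_coloring_def)
    show "proper_edge_coloring (E - {{x, z}}) ?c"
      unfolding proper_edge_coloring_def
    proof (intro ballI impI)
      fix e f assume ef: "e \<in> E - {{x, z}}" "f \<in> E - {{x, z}}" "e \<noteq> f \<and> e \<inter> f \<noteq> {}"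
      consider "e = {x, y}" | "f = {x, y}" | "e \<noteq> {x, y}" "f \<noteq> {x, y}" by blast
      then show "?c e \<noteq> ?c f"
      proof cases
        case 1
        then show ?thesis using new[of f] ef by metis
      next
        case 2
        then show ?thesis using new[of e] ef by (metis inf_commute)
      next
        case 3
        then show ?thesis using old[of e f] ef by simp
      qed
    qed
    show "?c ` (E - {{x, z}}) \<subseteq> D"
      using Cons.prems(2) xz by auto
    show "\<And>u. u \<in> set (z # zs) \<Longrightarrow> {x, u} \<in> E" "x \<notin> set (z # zs)" "distinct (z # zs)" "b \<in> D"
      using Cons.prems by auto
    have "successively (\<lambda>u v. free (E - {{x, y}}) c u (c {x, v})) (z # zs)"
      using Cons.prems(6) by simp
    then show "successively (\<lambda>u v. free (E - {{x, z}}) ?c u (?c {x, v})) (z # zs)"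
    proof (rule successively_mono)
      fix u v assume uv: "u \<in> set (z # zs)" "v \<in> set (z # zs)"
        and "free (E - {{x, y}}) c u (c {x, v})"
      moreover have "u \<noteq> x" "u \<noteq> y" "{x, v} \<noteq> {x, y}"
        using Cons.prems(4,5) uv by (auto simp: doubleton_eq_iff)
      ultimately show "free (E - {{x, z}}) ?c u (?c {x, v})"
        using free_mono[of u "c {x, v}"] by simp
    qed
    \<comment> \<open>The color of \<open>{x, z}\<close> has merely moved to \<open>{x, y}\<close>,
      so no new color appears at \<open>x\<close>.\<close>
    show "free (E - {{x, z}}) ?c x b"
      using Cons.prems(7) xz unfolding free_def by auto
    have "last (z # zs) \<in> set (z # zs)" by (rule last_in_set) simp
    then have "last (z # zs) \<noteq> x" "last (z # zs) \<noteq> y"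
      using Cons.prems(4,5) by auto
    moreover have "free (E - {{x, y}}) c (last (z # zs)) b"
      using Cons.prems(8) by simp
    ultimately show "free (E - {{x, z}}) ?c (last (z # zs)) b"
      using free_mono by blast
  qed
qed

text \<open>Take a longest fan, with last vertex \<open>l\<close>, and colors \<open>a\<close> free
  at \<open>x\<close> and \<open>b\<close> free at \<open>l\<close>. If \<open>b\<close> is free at
  \<open>x\<close>, rotate. Otherwise the edge of color \<open>b\<close> at \<open>x\<close> leads
  to a fan vertex \<open>z\<close>, as the fan could be prolonged if not, and \<open>b\<close> is
  also free at the predecessor \<open>u\<close> of \<open>z\<close>. Swapping \<open>a\<close> and
  \<open>b\<close> on the component of \<open>x\<close> makes \<open>b\<close> free at
  \<open>x\<close>. The component misses \<open>u\<close> or \<open>l\<close>: in the first case the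
  fan up to \<open>u\<close> can be rotated, otherwise the whole fan.\<close>

lemma vizing_extend:
  fixes E :: "'a set set" and c :: "'a set \<Rightarrow> nat"
  assumes fin: "finite E" and card2: "\<And>e. e \<in> E \<Longrightarrow> card e = 2"
    and deg: "\<And>v. degree E v \<le> d" and xy: "{x, y} \<in> E"
    and proper: "proper_edge_coloring (E - {{x, y}}) c"
    and colors: "c ` (E - {{x, y}}) \<subseteq> {..d}"
  shows "\<exists>c' :: 'a set \<Rightarrow> nat. proper_edge_coloring E c' \<and> c' ` E \<subseteq> {..d}"
proof -
  let ?E = "E - {{x, y}}"
  define fan where "fan ys \<longleftrightarrow> (\<forall>u\<in>set (y # ys). {x, u} \<in> E) \<and> distinct (y # ys) \<and>
    successively (\<lambda>u v. free ?E c u (c {x, v})) (y # ys)" for ys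
  have no_loop: "u \<noteq> x" if "{x, u} \<in> E" for u
    using card2[OF that] by auto
  have "finite (\<Union>E)"
    using fin card2 by (metis card.infinite finite_Union zero_neq_numeral)
  \<comment> \<open>Fans have distinct vertices, so their length is bounded and a longest one
    exists.\<close>
  then have "length ys < Suc (card (\<Union>E))" if "fan ys" for ys
  proof -
    have "length ys = card (set ys)"
      using that by (simp add: fan_def distinct_card)
    also have "\<dots> \<le> card (\<Union>E)"
      using that \<open>finite (\<Union>E)\<close> by (intro card_mono) (auto simp: fan_def)
    finally show ?thesis by simp
  qed
  moreover have "fan []" using xy by (simp add: fan_def)
  ultimately obtain ys where ys: "fan ys" and max: "\<And>zs. fan zs \<Longrightarrow> length zs \<le> length ys"
    using ex_has_greatest_nat[of fan "[]" length] by metis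
  have nbr: "\<And>u. u \<in> set (y # ys) \<Longrightarrow> {x, u} \<in> E" and dist: "distinct (y # ys)"
    and succ: "successively (\<lambda>u v. free ?E c u (c {x, v})) (y # ys)"
    using ys unfolding fan_def by auto
  have x_notin: "x \<notin> set (y # ys)" using nbr no_loop by blast
  have "degree ?E v \<le> d" for v
  proof -
    have "degree ?E v \<le> degree E v"
      unfolding degree_def using fin by (intro card_mono) auto
    then show ?thesis using deg[of v] by simp
  qed
  then have free_ex: "\<exists>a\<le>d. free ?E c v a" for v
    using fin by (intro exists_free_color) auto
  obtain a where a: "a \<le> d" "free ?E c x a" using free_ex by blast
  define l where "l = last (y # ys)"
  obtain b where b: "b \<le> d" "free ?E c l b" using free_ex by blast
  have l_in: "l \<in> set (y # ys)" unfolding l_def by (rule last_in_set) simp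
  show ?thesis
  proof (cases "free ?E c x b")
    case True
    show ?thesis
      by (rule fan_rotation[OF proper colors nbr x_notin dist succ True])
         (use b in \<open>auto simp: l_def\<close>)
  next
    case False
    then obtain e where e: "e \<in> ?E" "x \<in> e" "c e = b" by (auto simp: free_def)
    have "card e = 2" using e(1) card2 by simp
    then obtain z where z: "e = {x, z}"
      using e(2) by (auto simp: card_2_iff)
    have xz: "{x, z} \<in> ?E" "c {x, z} = b" using e z by auto
    have "z \<in> set (y # ys)"
    proof (rule ccontr)
      assume "z \<notin> set (y # ys)"
      moreover have "successively (\<lambda>u v. free ?E c u (c {x, v})) ((y # ys) @ [z])"
        using succ b(2) xz(2) unfolding successively_append_iff l_def by simp
      ultimately have "fan (ys @ [z])"
        using nbr dist xz(1) unfolding fan_def by auto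
      then show False using max[of "ys @ [z]"] by simp
    qed
    \<comment> \<open>The edge \<open>{x, y}\<close> is uncolored, so \<open>z\<close> is not the
      first fan vertex and has a predecessor.\<close>
    moreover have "z \<noteq> y" using xz by auto
    ultimately obtain p q where pq: "ys = p @ z # q" by (auto simp: in_set_conv_decomp)
    define u where "u = last (y # p)"
    have u_in: "u \<in> set (y # p)" unfolding u_def by (rule last_in_set) simp
    have succ_p: "successively (\<lambda>u v. free ?E c u (c {x, v})) (y # p)"
      and u_free: "free ?E c u b"
      using succ xz(2) unfolding pq append_Cons[symmetric] successively_append_iff u_def by auto
    have ul: "u \<noteq> l"
    proof -
      have "l \<in> set (z # q)" unfolding l_def pq by (simp add: last_append)
      then show ?thesis using u_in dist pq by auto
    qed
    have ux: "u \<noteq> x" and lx: "l \<noteq> x"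
      using u_in l_in x_notin pq by auto
    define f g where "f = partner ?E c a" and "g = partner ?E c b"
    define K where "K = orbit2 f g x"
    have xK: "x \<in> K" unfolding K_def by (rule orbit2.base)
    have closed: "e \<subseteq> K" if e: "e \<in> ?E" "c e \<in> {a, b}" "e \<inter> K \<noteq> {}" for e
    proof -
      obtain v where v: "v \<in> e" "v \<in> K" using e(3) by auto
      have "card e = 2" using e(1) card2 by simp
      then obtain w where w: "e = {v, w}" using v(1) by (auto simp: card_2_iff)
      then have "w = f v \<or> w = g v"
        using partner_eq[OF proper, of v w] e unfolding f_def g_def by auto
      then have "w \<in> K" using v(2) orbit2.intros(2,3) unfolding K_def by metis
      then show ?thesis using v w by simp
    qed
    let ?c = "kempe_swap a b K c"
    have proper': "proper_edge_coloring ?E ?c"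
      using closed proper by (rule kempe_swap_proper)
    have free': "free ?E ?c v r \<longleftrightarrow> free ?E c v (if v \<in> K then transpose a b r else r)" for v r
      using closed by (rule kempe_swap_free)
    have colors': "?c ` ?E \<subseteq> {..d}"
    proof -
      have "transpose a b r \<le> d" if "r \<le> d" for r
        using that a(1) b(1) by (simp add: transpose_def)
      then show ?thesis using colors by (auto simp: kempe_swap_def)
    qed
    have x_free': "free ?E ?c x b" using free' xK a by simp
    \<comment> \<open>A free color makes a vertex an end of its path: \<open>a\<close> at
      \<open>x\<close>, and \<open>b\<close> at \<open>u\<close> and at \<open>l\<close>. A path
      from \<open>x\<close> has only one further end.\<close>
    have not_both: "u \<notin> K \<or> l \<notin> K"
    proof (rule ccontr)
      assume "\<not> ?thesis"
      moreover have "f x = x" "g u = u" "g l = l"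
        unfolding f_def g_def using a(2) b(2) u_free by (auto intro!: partner_free)
      moreover have "\<And>v. f (f v) = v" "\<And>v. g (g v) = v"
        unfolding f_def g_def using partner_partner[OF proper] by auto
      ultimately have "u = l"
        using ux lx unfolding K_def by (intro orbit2_unique_end[of f g x u l]) auto
      then show False using ul by simp
    qed
    text \<open>Of the edges from \<open>x\<close> to the fan only \<open>{x, z}\<close>, whose color is \<open>b\<close>, is recolored.\<close>
    have fan_step: "free ?E ?c r (?c {x, s})"
      if "s \<in> set ys" "s \<noteq> z" "free ?E c r (c {x, s})" for r s
    proof -
      have xs: "{x, s} \<in> ?E"
        using that(1) nbr[of s] dist by (auto simp: doubleton_eq_iff)
      moreover have "{x, s} \<noteq> {x, z}" using that(2) by (auto simp: doubleton_eq_iff)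
      ultimately have "c {x, s} \<noteq> b"
        using proper_edge_coloringD[OF proper, of "{x, s}" "{x, z}" x] xz by auto
      moreover have "c {x, s} \<noteq> a" using a(2) xs by (auto simp: free_def)
      ultimately show ?thesis using that(3) by (simp add: kempe_swap_def free')
    qed
    show ?thesis
    proof (cases "u \<in> K")
      case False
      show ?thesis
      proof (rule fan_rotation[OF proper' colors' _ _ _ _ x_free'])
        show "\<And>v. v \<in> set (y # p) \<Longrightarrow> {x, v} \<in> E" "x \<notin> set (y # p)" "distinct (y # p)"
          using nbr x_notin dist pq by auto
        have "z \<notin> set p" using dist pq by auto
        \<comment> \<open>Recording that \<open>v\<close> lies in \<open>p\<close> keeps it apart
          from \<open>z\<close>, as \<open>fan_step\<close> requires.\<close>
        have "successively (\<lambda>u v. free ?E c u (c {x, v}) \<and> v \<in> set p) (y # p)"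
          using succ_p by (auto simp: successively_conv_nth)
        then show "successively (\<lambda>u v. free ?E ?c u (?c {x, v})) (y # p)"
          using fan_step pq \<open>z \<notin> set p\<close> by (auto elim!: successively_mono)
        show "free ?E ?c (last (y # p)) b"
          using False u_free free' unfolding u_def by simp
        show "b \<in> {..d}" using b by simp
      qed
    next
      case True
      then have lK: "l \<notin> K" using not_both by simp
      show ?thesis
      proof (rule fan_rotation[OF proper' colors' nbr x_notin dist _ x_free'])
        \<comment> \<open>The swap turns \<open>{x, z}\<close> from \<open>b\<close> to
          \<open>a\<close>, and at \<open>u\<close>, which lies in \<open>K\<close>, it turns the
          free color \<open>b\<close> into the free color \<open>a\<close>.\<close>
        have z_step: "free ?E ?c u (?c {x, z})"
          using True u_free xz(2) xK by (simp add: free' kempe_swap_def)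
        have succ_parts: "successively (\<lambda>u v. free ?E c u (c {x, v})) (z # q)"
          using succ unfolding pq append_Cons[symmetric] successively_append_iff by auto
        have "z \<notin> set p" "z \<notin> set q" using dist pq by auto
        have "successively (\<lambda>u v. free ?E c u (c {x, v}) \<and> v \<in> set p) (y # p)"
          using succ_p by (auto simp: successively_conv_nth)
        then have "successively (\<lambda>u v. free ?E ?c u (?c {x, v})) (y # p)"
          using fan_step pq \<open>z \<notin> set p\<close> by (auto elim!: successively_mono)
        moreover have "successively (\<lambda>u v. free ?E c u (c {x, v}) \<and> v \<in> set q) (z # q)"
          using succ_parts by (auto simp: successively_conv_nth)
        then have "successively (\<lambda>u v. free ?E ?c u (?c {x, v})) (z # q)"
          using fan_step pq \<open>z \<notin> set q\<close> by (auto elim!: successively_mono)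
        ultimately show "successively (\<lambda>u v. free ?E ?c u (?c {x, v})) (y # ys)"
          using z_step unfolding pq append_Cons[symmetric] successively_append_iff u_def by auto
        show "free ?E ?c (last (y # ys)) b"
          using lK b(2) free' unfolding l_def by simp
        show "b \<in> {..d}" using b by simp
      qed
    qed
  qed
qed

text \<open>Edges are inserted one at a time, each by \<open>vizing_extend\<close>. The set
  \<open>{..d}\<close> has \<open>d + 1\<close> colors.\<close>

theorem vizing:
  fixes E :: "'a set set"
  assumes "finite E" "\<And>e. e \<in> E \<Longrightarrow> card e = 2" "\<And>v. degree E v \<le> d"
  shows "\<exists>c :: 'a set \<Rightarrow> nat. proper_edge_coloring E c \<and> c ` E \<subseteq> {..d}"
  using assms
proof (induction E rule: finite_induct)
  case empty
  then show ?case by (simp add: proper_edge_coloring_def)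
next
  case (insert e E)
  have "degree E v \<le> d" for v
  proof -
    have "degree E v \<le> degree (insert e E) v"
      unfolding degree_def using insert.hyps(1) by (intro card_mono) auto
    then show ?thesis using insert.prems(2)[of v] by simp
  qed
  then obtain c :: "'a set \<Rightarrow> nat" where c: "proper_edge_coloring E c" "c ` E \<subseteq> {..d}"
    using insert.IH insert.prems(1) by auto
  obtain x y where e: "e = {x, y}"
    using insert.prems(1)[of e] by (auto simp: card_2_iff)
  have E: "insert e E - {{x, y}} = E" using insert.hyps(2) e by auto
  show ?case
    by (rule vizing_extend[where x = x and y = y and c = c])
       (use insert.hyps(1) insert.prems c e E in auto)
qed

section \<open>Large complete graphs contain rainbow copies\<close>

abbreviation complete_edges :: "'a set \<Rightarrow> 'a set set" where
  "complete_edges V \<equiv> {e. e \<subseteq> V \<and> card e = 2}"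

lemma finite_complete_edges: "finite V \<Longrightarrow> finite (complete_edges V)"
  by (rule finite_subset[of _ "Pow V"]) auto

lemma card_complete_edges_le:
  assumes "finite V"
  shows "card (complete_edges V) \<le> card V * card V"
proof -
  have "complete_edges V \<subseteq> (\<lambda>(u, v). {u, v}) ` (V \<times> V)"
    by (auto simp: card_2_iff)
  then have "card (complete_edges V) \<le> card (V \<times> V)"
    using assms by (intro surj_card_le) auto
  then show ?thesis by (simp add: card_cartesian_product)
qed

text \<open>Greedy choice of vertices. A new vertex \<open>v\<close> is bad only if an edge
  \<open>{u, v}\<close> with \<open>u\<close> in \<open>W\<close> repeats a color used inside
  \<open>W\<close>. By properness each pair of a vertex \<open>u\<close> and a color excludes at
  most one \<open>v\<close>, and edges that meet in \<open>v\<close> differ in color anyway.\<close>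

lemma rainbow_clique:
  assumes V: "finite V" "card V > n * (n * n) + n"
    and c: "proper_edge_coloring (complete_edges V) c"
    and "s \<le> n"
  shows "\<exists>W\<subseteq>V. card W = s \<and> inj_on c (complete_edges W)"
  using \<open>s \<le> n\<close>
proof (induction s)
  case 0
  have "complete_edges {} = {}" by auto
  then show ?case by (intro exI[of _ "{}"]) (simp add: inj_on_def)
next
  case (Suc s)
  then obtain W where W: "W \<subseteq> V" "card W = s" "inj_on c (complete_edges W)" by auto
  have finW: "finite W" using W(1) V(1) finite_subset by blast
  define bad where "bad u r = {v \<in> V - W. c {u, v} = r}" for u r
  have bad_card: "card (bad u r) \<le> 1" "finite (bad u r)" if "u \<in> W" for u r
  proof -
    show "finite (bad u r)" using V(1) by (simp add: bad_def)
    have "v = w" if vw: "v \<in> bad u r" "w \<in> bad u r" for v w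
    proof (rule ccontr)
      assume "v \<noteq> w"
      moreover have "{u, v} \<in> complete_edges V" "{u, w} \<in> complete_edges V"
        using vw W(1) \<open>u \<in> W\<close> by (auto simp: bad_def card_insert_if)
      moreover have "{u, v} \<noteq> {u, w}" using \<open>v \<noteq> w\<close> by (auto simp: doubleton_eq_iff)
      ultimately show False
        using proper_edge_coloringD[OF c, of "{u, v}" "{u, w}" u] vw by (auto simp: bad_def)
    qed
    then show "card (bad u r) \<le> 1"
      using \<open>finite (bad u r)\<close> by (simp add: card_le_Suc0_iff_eq)
  qed
  let ?C = "c ` complete_edges W"
  let ?B = "\<Union>(u, r)\<in>W \<times> ?C. bad u r"
  have finC: "finite ?C" by (intro finite_imageI finite_complete_edges finW)
  have "card ?B \<le> (\<Sum>p\<in>W \<times> ?C. card (case p of (u, r) \<Rightarrow> bad u r))"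
    using finW finC by (intro card_UN_le) auto
  also have "\<dots> \<le> (\<Sum>p\<in>W \<times> ?C. 1)"
    using bad_card by (intro sum_mono) auto
  also have "\<dots> = s * card ?C" using W(2) by (simp add: card_cartesian_product)
  \<comment> \<open>At most \<open>n\<close> vertices \<open>u\<close>, and at most
    \<open>n * n\<close> colors by the crude bound on the edges of \<open>W\<close>.\<close>
  also have "\<dots> \<le> n * (n * n)"
  proof -
    have "card ?C \<le> card (complete_edges W)"
      by (intro card_image_le finite_complete_edges finW)
    also have "\<dots> \<le> s * s" using card_complete_edges_le[OF finW] W(2) by simp
    also have "\<dots> \<le> n * n" using Suc.prems by (intro mult_le_mono) auto
    finally show ?thesis using Suc.prems by (intro mult_le_mono) auto
  qed
  finally have "card (W \<union> ?B) \<le> n + n * (n * n)"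
    using card_Un_le[of W ?B] W(2) Suc.prems by simp
  moreover have "finite (W \<union> ?B)" using finW finC bad_card(2) by auto
  ultimately have "\<not> V \<subseteq> W \<union> ?B"
    using V(2) card_mono[of "W \<union> ?B" V] by linarith
  then obtain v where v: "v \<in> V" "v \<notin> W" "v \<notin> ?B" by blast
  have new: "c {u, v} \<notin> ?C" if "u \<in> W" for u
    using v that by (auto simp: bad_def)
  have edges: "complete_edges (insert v W) = complete_edges W \<union> (\<lambda>u. {u, v}) ` W"
  proof -
    have "e \<in> (\<lambda>u. {u, v}) ` W" if e: "e \<subseteq> insert v W" "card e = 2" "\<not> e \<subseteq> W" for e
    proof -
      obtain u w where "e = {u, w}" "u \<noteq> w" using e(2) by (auto simp: card_2_iff)
      then show ?thesis using e by auto
    qed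
    then show ?thesis using v(2) by (auto simp: card_insert_if)
  qed
  have "inj_on c (complete_edges (insert v W))"
    unfolding edges
  proof (rule inj_on_Un[THEN iffD2], intro conjI)
    show "inj_on c (complete_edges W)" by (rule W(3))
    show "inj_on c ((\<lambda>u. {u, v}) ` W)"
    proof (rule inj_onI)
      fix e f assume ef: "e \<in> (\<lambda>u. {u, v}) ` W" "f \<in> (\<lambda>u. {u, v}) ` W" "c e = c f"
      have "e \<in> complete_edges V" "f \<in> complete_edges V" "v \<in> e" "v \<in> f"
        using ef(1,2) v W(1) by (auto simp: card_insert_if)
      then show "e = f"
        using proper_edge_coloringD[OF c] ef(3) by blast
    qed
    show "c ` (complete_edges W - (\<lambda>u. {u, v}) ` W) \<inter>
        c ` ((\<lambda>u. {u, v}) ` W - complete_edges W) = {}"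
    proof -
      have "r \<notin> ?C" if "r \<in> c ` (\<lambda>u. {u, v}) ` W" for r
        using that new by (elim imageE) simp
      moreover have "c ` (complete_edges W - (\<lambda>u. {u, v}) ` W) \<subseteq> ?C"
          "c ` ((\<lambda>u. {u, v}) ` W - complete_edges W) \<subseteq> c ` (\<lambda>u. {u, v}) ` W"
        by (intro image_mono Diff_subset)+
      ultimately show ?thesis by (meson disjoint_iff subsetD)
    qed
  qed
  moreover have "card (insert v W) = Suc s" using finW v W(2) by simp
  ultimately show ?case using v W(1) by (intro exI[of _ "insert v W"]) auto
qed

lemma simple_graph_finite:
  assumes "simple_graph V E"
  shows "finite V \<and> finite E"
proof -
  have "finite V" "E \<subseteq> Pow V" using assms by (auto simp: simple_graph_def)
  then show ?thesis by (meson finite_Pow_iff finite_subset)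
qed

text \<open>Guarantees that the minimum in \<open>AR_s\<close> is attained. In a rainbow clique on
  \<open>card V\<close> vertices, any bijection from \<open>V\<close> yields a rainbow copy.\<close>

lemma exists_forcing_graph:
  fixes V :: "'a set"
  assumes H: "simple_graph V E"
  shows "\<exists>(VG :: nat set) EG. simple_graph VG EG \<and> forces_rainbow VG EG V E"
proof -
  define n where "n = card V"
  define VG where "VG = {..< n * (n * n) + n + 1}"
  have "simple_graph VG (complete_edges VG)"
    by (auto simp: simple_graph_def VG_def)
  moreover have "forces_rainbow VG (complete_edges VG) V E"
    unfolding forces_rainbow_def
  proof (intro allI impI)
    fix c :: "nat set \<Rightarrow> nat" assume "proper_edge_coloring (complete_edges VG) c"
    then obtain W where W: "W \<subseteq> VG" "card W = n" "inj_on c (complete_edges W)"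
      using rainbow_clique[of VG n c n] by (auto simp: VG_def)
    have "finite W" using W(1) finite_subset by (auto simp: VG_def)
    then obtain \<phi> where \<phi>: "bij_betw \<phi> V W"
      using H W(2) finite_same_card_bij[of V W] by (auto simp: simple_graph_def n_def)
    define F where "F = (`) \<phi> ` E"
    have inj: "inj_on \<phi> V" and img: "\<phi> ` V = W" using \<phi> by (auto simp: bij_betw_def)
    have F: "F \<subseteq> complete_edges W"
    proof
      fix f assume "f \<in> F"
      then obtain e where e: "e \<in> E" "f = \<phi> ` e" by (auto simp: F_def)
      then have "e \<subseteq> V" "card e = 2" using H by (auto simp: simple_graph_def)
      then have "card f = 2" using e inj by (metis card_image inj_on_subset)
      then show "f \<in> complete_edges W" using e img \<open>e \<subseteq> V\<close> by auto
    qed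
    have "subgraph W F VG (complete_edges VG)"
      using F W(1) \<open>finite W\<close> by (auto simp: subgraph_def simple_graph_def)
    moreover have "{u, v} \<in> E \<longleftrightarrow> {\<phi> u, \<phi> v} \<in> F" if uv: "u \<in> V" "v \<in> V" for u v
    proof
      assume "{u, v} \<in> E" then have "\<phi> ` {u, v} \<in> F" unfolding F_def by (rule imageI)
      then show "{\<phi> u, \<phi> v} \<in> F" by simp
    next
      assume "{\<phi> u, \<phi> v} \<in> F"
      then obtain e where e: "e \<in> E" "\<phi> ` {u, v} = \<phi> ` e" by (auto simp: F_def)
      then have "e \<subseteq> V" using H by (auto simp: simple_graph_def)
      then have "{u, v} = e" using e(2) uv inj inj_on_image_eq_iff[of \<phi> V "{u, v}" e] by simp
      then show "{u, v} \<in> E" using e(1) by simp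
    qed
    then have "isomorphic V E W F" using \<phi> unfolding isomorphic_def by blast
    moreover have "rainbow F c" using W(3) F unfolding rainbow_def by (rule inj_on_subset)
    ultimately show "\<exists>W F. subgraph W F VG (complete_edges VG) \<and> isomorphic V E W F \<and> rainbow F c"
      by blast
  qed
  ultimately show ?thesis by blast
qed

section \<open>Lower bounds\<close>

lemma isomorphic_edge_map:
  assumes "simple_graph V E" "simple_graph W F" "isomorphic V E W F"
  obtains \<phi> where "bij_betw \<phi> V W" "bij_betw ((`) \<phi>) E F"
proof -
  obtain \<phi> where \<phi>: "bij_betw \<phi> V W"
    and E_F: "\<And>u v. u \<in> V \<Longrightarrow> v \<in> V \<Longrightarrow> {u, v} \<in> E \<longleftrightarrow> {\<phi> u, \<phi> v} \<in> F"
    using assms(3) by (auto simp: isomorphic_def)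
  have inj: "inj_on \<phi> V" and img: "\<phi> ` V = W" using \<phi> by (auto simp: bij_betw_def)
  have "inj_on ((`) \<phi>) E"
    using inj_on_image_Pow[OF inj] assms(1) by (auto simp: simple_graph_def intro: inj_on_subset)
  moreover have "(`) \<phi> ` E = F"
  proof (intro equalityI subsetI)
    fix f assume "f \<in> (`) \<phi> ` E"
    then obtain e where e: "e \<in> E" "f = \<phi> ` e" by auto
    then have "e \<subseteq> V" "card e = 2" using assms(1) by (auto simp: simple_graph_def)
    then obtain u v where "e = {u, v}" "u \<in> V" "v \<in> V" by (auto simp: card_2_iff)
    then show "f \<in> F" using e E_F by auto
  next
    fix f assume f: "f \<in> F"
    then have "f \<subseteq> W" "card f = 2" using assms(2) by (auto simp: simple_graph_def)
    then obtain u v where "f = {\<phi> u, \<phi> v}" "u \<in> V" "v \<in> V"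
      using img by (auto simp: card_2_iff)
    then show "f \<in> (`) \<phi> ` E" using f E_F by (intro image_eqI[of _ _ "{u, v}"]) auto
  qed
  ultimately show ?thesis using that \<phi> by (simp add: bij_betw_def)
qed

lemma isomorphic_degree_le:
  assumes "simple_graph V E" "simple_graph W F" "isomorphic V E W F"
    and "\<And>v. v \<in> V \<Longrightarrow> degree E v \<le> d"
  shows "degree F w \<le> d"
proof (cases "w \<in> W")
  case True
  obtain \<phi> where \<phi>: "bij_betw \<phi> V W" and edges: "bij_betw ((`) \<phi>) E F"
    using isomorphic_edge_map[OF assms(1-3)] by blast
  obtain v where v: "v \<in> V" "w = \<phi> v" using True \<phi> by (auto simp: bij_betw_def)
  have "{f \<in> F. w \<in> f} \<subseteq> (`) \<phi> ` {e \<in> E. v \<in> e}"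
  proof
    fix f assume f: "f \<in> {f \<in> F. w \<in> f}"
    then obtain e where e: "e \<in> E" "f = \<phi> ` e" using edges by (auto simp: bij_betw_def)
    then have "e \<subseteq> V" using assms(1) by (auto simp: simple_graph_def)
    then have "v \<in> e"
      using f e v \<phi> inj_on_image_mem_iff[of \<phi> V v e] by (auto simp: bij_betw_def)
    then show "f \<in> (`) \<phi> ` {e \<in> E. v \<in> e}" using e by auto
  qed
  moreover have "finite {e \<in> E. v \<in> e}" using simple_graph_finite[OF assms(1)] by simp
  ultimately have "degree F w \<le> degree E v"
    unfolding degree_def by (rule surj_card_le[rotated])
  then show ?thesis using assms(4)[OF v(1)] by simp
next
  case False
  then have none: "{f \<in> F. w \<in> f} = {}" using assms(2) by (auto simp: simple_graph_def)
  show ?thesis unfolding degree_def none by simp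
qed

lemma isomorphic_proper_coloring:
  assumes "simple_graph V E" "simple_graph W F" "isomorphic V E W F"
    and "proper_edge_coloring E c"
  obtains c' where "proper_edge_coloring F c'" "c' ` F = c ` E"
proof -
  obtain \<phi> where \<phi>: "bij_betw \<phi> V W" and edges: "bij_betw ((`) \<phi>) E F"
    using isomorphic_edge_map[OF assms(1-3)] by blast
  let ?i = "inv_into E ((`) \<phi>)"
  have img: "?i ` F = E" using edges by (metis bij_betw_def bij_betw_inv_into)
  have "proper_edge_coloring F (c \<circ> ?i)"
    unfolding proper_edge_coloring_def
  proof (intro ballI impI)
    fix e f assume ef: "e \<in> F" "f \<in> F" "e \<noteq> f \<and> e \<inter> f \<noteq> {}"
    have ie: "?i e \<in> E" "?i f \<in> E" using ef img by auto
    have im: "\<phi> ` ?i e = e" "\<phi> ` ?i f = f"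
      using ef edges by (auto simp: bij_betw_def intro: f_inv_into_f)
    have "?i e \<subseteq> V" "?i f \<subseteq> V" using ie assms(1) by (auto simp: simple_graph_def)
    then have "\<phi> ` (?i e \<inter> ?i f) = e \<inter> f"
      using \<phi> im inj_on_image_Int[of \<phi> V "?i e" "?i f"] by (auto simp: bij_betw_def)
    then have "?i e \<inter> ?i f \<noteq> {}" using ef by auto
    moreover have "?i e \<noteq> ?i f" using im ef(3) by metis
    ultimately show "(c \<circ> ?i) e \<noteq> (c \<circ> ?i) f"
      using assms(4) ie by (simp add: proper_edge_coloring_def)
  qed
  moreover have "(c \<circ> ?i) ` F = c ` E" using img by (metis image_comp)
  ultimately show ?thesis using that by blast
qed

section \<open>Counting the edges of a forcing graph\<close>

text \<open>Keep the given coloring on \<open>U\<close> and give every other edge its own color: a rainbow copy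
  can use at most \<open>r\<close> edges of \<open>U\<close>.\<close>

lemma copy_avoiding_colored_part:
  fixes VG :: "'b set" and c :: "'b set \<Rightarrow> nat"
  assumes H: "simple_graph V E" and G: "simple_graph VG EG" "forces_rainbow VG EG V E"
    and U: "U \<subseteq> EG" "proper_edge_coloring U c" "card (c ` U) \<le> r"
  obtains W F where "subgraph W F VG EG" "isomorphic V E W F" "card E - r \<le> card (F - U)"
proof -
  have finEG: "finite EG" using simple_graph_finite[OF G(1)] by simp
  then obtain idx :: "'b set \<Rightarrow> nat" where idx: "inj_on idx EG"
    using finite_imp_inj_to_nat_seg by blast
  \<comment> \<open>Even colors on \<open>U\<close> and odd colors elsewhere, so the two kinds never
    clash.\<close>
  define c' where "c' e = (if e \<in> U then 2 * c e else 2 * idx e + 1)" for e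
  have "proper_edge_coloring EG c'"
    unfolding proper_edge_coloring_def
  proof (intro ballI impI)
    fix e f assume ef: "e \<in> EG" "f \<in> EG" "e \<noteq> f \<and> e \<inter> f \<noteq> {}"
    have "idx e \<noteq> idx f" using idx ef by (auto dest: inj_onD)
    moreover have "c e \<noteq> c f" if "e \<in> U" "f \<in> U"
      using U(2) that ef by (auto simp: proper_edge_coloring_def)
    moreover have "2 * m \<noteq> Suc (2 * n)" "Suc (2 * n) \<noteq> 2 * m" for m n :: nat by presburger+
    ultimately show "c' e \<noteq> c' f" by (auto simp: c'_def)
  qed
  then obtain W F where F: "subgraph W F VG EG" "isomorphic V E W F" "rainbow F c'"
    using G(2) unfolding forces_rainbow_def by blast
  have "simple_graph W F" using F(1) by (simp add: subgraph_def)
  then obtain \<phi> :: "'a \<Rightarrow> 'b" where "bij_betw ((`) \<phi>) E F"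
    using isomorphic_edge_map[OF H _ F(2)] by blast
  then have card_F: "card F = card E" using bij_betw_same_card by metis
  have finF: "finite F" using simple_graph_finite[OF \<open>simple_graph W F\<close>] by simp
  have "inj_on c' (F \<inter> U)" using F(3) unfolding rainbow_def by (rule inj_on_subset) auto
  then have "inj_on c (F \<inter> U)" by (auto simp: inj_on_def c'_def)
  moreover have "c ` (F \<inter> U) \<subseteq> c ` U" by auto
  moreover have "finite (c ` U)" using finEG U(1) finite_subset by blast
  ultimately have "card (F \<inter> U) \<le> card (c ` U)" by (rule card_inj_on_le)
  then have "card E - r \<le> card (F - U)"
    using U(3) card_F finF by (simp add: card_Diff_subset_Int)
  then show ?thesis using that F by blast
qed

text \<open>The common frame of both bounds: \<open>Q i U\<close> is the invariant of the part
  \<open>U\<close> built in \<open>i\<close> steps. The factor \<open>s\<close> expresses a gain of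
  at least \<open>g i / s\<close> edges without division.\<close>

lemma iterated_extension_card:
  fixes g :: "nat \<Rightarrow> nat"
  assumes "finite S" "Q 0 {}"
    and step: "\<And>i U. U \<subseteq> S \<Longrightarrow> Q i U \<Longrightarrow>
      \<exists>M \<subseteq> S - U. Q (Suc i) (U \<union> M) \<and> g i \<le> s * card M"
  shows "(\<Sum>i<n. g i) \<le> s * card S"
proof -
  have "\<exists>U\<subseteq>S. Q n U \<and> (\<Sum>i<n. g i) \<le> s * card U"
  proof (induction n)
    case 0
    then show ?case using assms(2) by auto
  next
    case (Suc n)
    then obtain U where U: "U \<subseteq> S" "Q n U" "(\<Sum>i<n. g i) \<le> s * card U" by blast
    then obtain M where M: "M \<subseteq> S - U" "Q (Suc n) (U \<union> M)" "g n \<le> s * card M"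
      using step[OF U(1,2)] by auto
    have "finite U" "finite M" using U(1) M(1) assms(1) by (meson finite_subset finite_Diff)+
    then have "card (U \<union> M) = card U + card M" using M(1) by (intro card_Un_disjoint) auto
    then have "(\<Sum>i<Suc n. g i) \<le> s * card (U \<union> M)"
      using U(3) M(3) by (simp add: distrib_left)
    moreover have "U \<union> M \<subseteq> S" using U(1) M(1) by auto
    ultimately show ?case using M(2) by (intro exI[of _ "U \<union> M"] conjI)
  qed
  then obtain U where "U \<subseteq> S" "(\<Sum>i<n. g i) \<le> s * card U" by blast
  then show ?thesis using card_mono[OF assms(1), of U] by (meson le_trans mult_le_mono2)
qed

text \<open>Induction from \<open>m - d\<close> to \<open>m\<close>: the first term contributes
  \<open>m\<close>, the rest contains the sum for \<open>m - d\<close>, and the squares differ by at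
  most \<open>2 * d * m\<close>. For \<open>m \<le> d\<close> the first term alone suffices.\<close>

lemma sum_truncated_progression:
  fixes m d :: nat
  assumes "d \<ge> 1"
  shows "m\<^sup>2 \<le> 2 * d * (\<Sum>i<Suc m. m - i * d)"
proof (induction m rule: less_induct)
  case (less m)
  show ?case
  proof (cases "m \<le> d")
    case True
    have "m\<^sup>2 \<le> 2 * d * m" using True by (simp add: power2_eq_square)
    also have "\<dots> \<le> 2 * d * (\<Sum>i<Suc m. m - i * d)"
      by (intro mult_le_mono2) (simp add: sum.lessThan_Suc_shift del: sum.lessThan_Suc)
    finally show ?thesis .
  next
    case False
    define j where "j = m - d"
    have m: "m = j + d" "j < m" using False assms by (auto simp: j_def)
    have "(\<Sum>i<Suc j. j - i * d) \<le> (\<Sum>i<m. j - i * d)"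
      using m by (intro sum_mono2) auto
    also have "\<dots> = (\<Sum>i<m. m - Suc i * d)"
      using m(1) by (intro sum.cong) auto
    finally have "m + (\<Sum>i<Suc j. j - i * d) \<le> (\<Sum>i<Suc m. m - i * d)"
      by (simp add: sum.lessThan_Suc_shift del: sum.lessThan_Suc)
    then have "2 * d * (m + (\<Sum>i<Suc j. j - i * d)) \<le> 2 * d * (\<Sum>i<Suc m. m - i * d)"
      by (rule mult_le_mono2)
    moreover have "m\<^sup>2 \<le> 2 * d * m + j\<^sup>2"
      unfolding m(1) by (simp add: power2_eq_square algebra_simps)
    ultimately show ?thesis
      using less.IH[OF m(2)] by (simp add: distrib_left del: sum.lessThan_Suc)
  qed
qed

text \<open>The invariant is the degree bound \<open>i * d\<close>, which is what Vizing's theorem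
  needs and which grows by at most \<open>d\<close> with each added copy. The one extra color of
  Vizing's theorem turns \<open>card E\<close> into \<open>card E - 1\<close>.\<close>

lemma forcing_card_ge:
  fixes VG :: "'b set"
  assumes H: "simple_graph V E" "\<And>v. v \<in> V \<Longrightarrow> degree E v \<le> d" "d \<ge> 1"
    and G: "simple_graph VG EG" "forces_rainbow VG EG V E"
  shows "(card E - 1)\<^sup>2 \<le> 2 * d * card EG"
proof -
  let ?Q = "\<lambda>i U. \<forall>v. degree U v \<le> i * d"
  have finEG: "finite EG" using simple_graph_finite[OF G(1)] by simp
  have step: "\<exists>M \<subseteq> EG - U. ?Q (Suc i) (U \<union> M) \<and> card E - 1 - i * d \<le> 1 * card M"
    if U: "U \<subseteq> EG" "?Q i U" for i and U :: "'b set set"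
  proof -
    have "finite U" "\<And>e. e \<in> U \<Longrightarrow> card e = 2"
      using U(1) finEG G(1) finite_subset by (auto simp: simple_graph_def)
    then obtain c :: "'b set \<Rightarrow> nat" where c: "proper_edge_coloring U c" "c ` U \<subseteq> {..i * d}"
      using vizing[of U "i * d"] U(2) by blast
    have "card (c ` U) \<le> Suc (i * d)"
      using card_mono[OF _ c(2)] by simp
    then obtain W F where F: "subgraph W F VG EG" "isomorphic V E W F"
      "card E - Suc (i * d) \<le> card (F - U)"
      using copy_avoiding_colored_part[OF H(1) G U(1) c(1)] by blast
    have F': "simple_graph W F" "F \<subseteq> EG" using F(1) by (auto simp: subgraph_def)
    have "degree (U \<union> (F - U)) v \<le> Suc i * d" for v
    proof -
      have "degree (U \<union> (F - U)) v \<le> card ({e \<in> U. v \<in> e} \<union> {e \<in> F. v \<in> e})"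
        unfolding degree_def using \<open>finite U\<close> simple_graph_finite[OF F'(1)]
        by (intro card_mono) auto
      also have "\<dots> \<le> degree U v + degree F v"
        unfolding degree_def by (rule card_Un_le)
      also have "\<dots> \<le> i * d + d"
        using U(2) isomorphic_degree_le[OF H(1) F'(1) F(2) H(2)] by (intro add_mono) auto
      finally show ?thesis by simp
    qed
    then show ?thesis using F(3) F'(2) by (intro exI[of _ "F - U"]) auto
  qed
  have "(\<Sum>i<Suc (card E - 1). card E - 1 - i * d) \<le> 1 * card EG"
    by (rule iterated_extension_card[where Q = ?Q, OF finEG _ step]) (auto simp: degree_def)
  then have "2 * d * (\<Sum>i<Suc (card E - 1). card E - 1 - i * d) \<le> 2 * d * card EG"
    by (intro mult_le_mono2) simp
  then show ?thesis
    using sum_truncated_progression[OF H(3), of "card E - 1"] by (rule le_trans[rotated])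
qed

text \<open>Averaging: \<open>M\<close> splits into at most \<open>d\<close> color classes. The
  colors are counted on \<open>F\<close> because this is applied to the part of a copy
  \<open>F\<close> that lies outside \<open>U\<close>.\<close>

lemma largest_color_class:
  assumes "finite F" "card (c ` F) \<le> d" "M \<subseteq> F"
  shows "\<exists>r. card M \<le> d * card {e \<in> M. c e = r}"
proof (rule ccontr)
  assume "\<not> ?thesis"
  then have less: "d * card {e \<in> M. c e = r} < card M" for r by (simp add: not_le)
  have finM: "finite M" using assms finite_subset by blast
  have M: "M = (\<Union>r\<in>c ` M. {e \<in> M. c e = r})" by auto
  have "card M \<le> (\<Sum>r\<in>c ` M. card {e \<in> M. c e = r})"
    using card_UN_le[of "c ` M" "\<lambda>r. {e \<in> M. c e = r}"] finM M by simp
  then have "d * card M \<le> (\<Sum>r\<in>c ` M. d * card {e \<in> M. c e = r})"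
    by (metis mult_le_mono2 sum_distrib_left)
  also have "\<dots> < (\<Sum>r\<in>c ` M. card M)"
  proof (rule sum_strict_mono)
    show "c ` M \<noteq> {}" using less by auto
  qed (use finM less in auto)
  also have "\<dots> = card (c ` M) * card M" by simp
  also have "\<dots> \<le> d * card M"
  proof (rule mult_le_mono1)
    have "card (c ` M) \<le> card (c ` F)" using assms(1,3) by (intro card_mono) auto
    then show "card (c ` M) \<le> d" using assms(2) by simp
  qed
  finally show False by simp
qed

text \<open>Adding only a matching costs one color per step, so the invariant is a coloring with the
  colors below \<open>i\<close>. The guaranteed gains, multiplied by \<open>d\<close>, are
  \<open>card E\<close>, \<open>card E - 1\<close>, down to \<open>1\<close>.\<close>

lemma forcing_card_ge_colorable:
  fixes VG :: "'b set" and c :: "'a set \<Rightarrow> nat"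
  assumes H: "simple_graph V E" "proper_edge_coloring E c" "card (c ` E) \<le> d"
    and G: "simple_graph VG EG" "forces_rainbow VG EG V E"
  shows "card E * (card E + 1) \<le> 2 * d * card EG"
proof -
  let ?Q = "\<lambda>i U. \<exists>c :: 'b set \<Rightarrow> nat. proper_edge_coloring U c \<and> c ` U \<subseteq> {..<i}"
  have finEG: "finite EG" using simple_graph_finite[OF G(1)] by simp
  have step: "\<exists>M \<subseteq> EG - U. ?Q (Suc i) (U \<union> M) \<and> card E - i \<le> d * card M"
    if U: "U \<subseteq> EG" "?Q i U" for i and U :: "'b set set"
  proof -
    obtain cU :: "'b set \<Rightarrow> nat" where cU: "proper_edge_coloring U cU" "cU ` U \<subseteq> {..<i}"
      using U(2) by blast
    have "card (cU ` U) \<le> i" using card_mono[OF _ cU(2)] by simp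
    then obtain W F where F: "subgraph W F VG EG" "isomorphic V E W F"
      "card E - i \<le> card (F - U)"
      using copy_avoiding_colored_part[OF H(1) G U(1) cU(1)] by blast
    have F': "simple_graph W F" "F \<subseteq> EG" using F(1) by (auto simp: subgraph_def)
    obtain cF where cF: "proper_edge_coloring F cF" "cF ` F = c ` E"
      using isomorphic_proper_coloring[OF H(1) F'(1) F(2) H(2)] by blast
    obtain r where r: "card (F - U) \<le> d * card {e \<in> F - U. cF e = r}"
      using largest_color_class[of F cF d "F - U"] simple_graph_finite[OF F'(1)] cF(2) H(3) by auto
    define M where "M = {e \<in> F - U. cF e = r}"
    \<comment> \<open>The color \<open>i\<close> is new to \<open>U\<close>, and it may be used on
      all of \<open>M\<close> since a color class is a matching.\<close>
    let ?c = "\<lambda>e. if e \<in> U then cU e else i"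
    have cU_less: "cU e < i" if "e \<in> U" for e using cU(2) that by auto
    have M_disj: "e \<inter> f = {}" if ef: "e \<in> M" "f \<in> M" "e \<noteq> f" for e f
    proof (rule ccontr)
      assume "e \<inter> f \<noteq> {}"
      then obtain v where "v \<in> e" "v \<in> f" by auto
      then show False
        using proper_edge_coloringD[OF cF(1), of e f v] ef by (simp add: M_def)
    qed
    have "proper_edge_coloring (U \<union> M) ?c"
      unfolding proper_edge_coloring_def
    proof (intro ballI impI)
      fix e f assume ef: "e \<in> U \<union> M" "f \<in> U \<union> M" "e \<noteq> f \<and> e \<inter> f \<noteq> {}"
      have "cU e \<noteq> cU f" if "e \<in> U" "f \<in> U"
        using cU(1) that ef(3) by (simp add: proper_edge_coloring_def)
      moreover have "e \<in> U \<or> f \<in> U" using M_disj[of e f] ef by auto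
      ultimately show "?c e \<noteq> ?c f" using cU_less[of e] cU_less[of f] by auto
    qed
    moreover have "?c ` (U \<union> M) \<subseteq> {..<Suc i}"
      using cU_less by (intro image_subsetI) (simp add: less_SucI)
    ultimately have "?Q (Suc i) (U \<union> M)" by blast
    moreover have "card E - i \<le> d * card M" using F(3) r by (simp add: M_def)
    moreover have "M \<subseteq> EG - U" using F'(2) by (auto simp: M_def)
    ultimately show ?thesis by blast
  qed
  have "(\<Sum>i<card E. card E - i) \<le> d * card EG"
    by (rule iterated_extension_card[where Q = ?Q, OF finEG _ step])
       (auto simp: proper_edge_coloring_def)
  moreover have "2 * (\<Sum>i<k. k - i) = k * (k + 1)" for k :: nat
    by (induction k) (simp_all add: sum.lessThan_Suc_shift algebra_simps del: sum.lessThan_Suc)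
  ultimately show ?thesis by (metis mult.assoc mult_le_mono2)
qed

theorem lemma5:
  fixes V :: "'a set" and E :: "'a set set" and k \<Delta> :: nat
  assumes "simple_graph V E"
    and "card E = k" and "k \<ge> 1"
    and "max_degree V E = \<Delta>"
  shows "real (AR_s V E) \<ge> (real k - 1)^2 / (2 * real \<Delta>)
    \<and> (chromatic_index E = \<Delta> \<longrightarrow>
         real (AR_s V E) \<ge> real k * (real k + 1) / (2 * real \<Delta>))"
proof -
  have fin: "finite V" "finite E" using simple_graph_finite[OF assms(1)] by auto
  have deg: "degree E v \<le> \<Delta>" if "v \<in> V" for v
    using that fin(1) assms(4) unfolding max_degree_def by (metis Max_ge finite_imageI imageI)
  have "E \<noteq> {}" using assms(2,3) by auto
  then obtain e where e: "e \<in> E" by blast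
  then have "e \<subseteq> V" "card e = 2" using assms(1) by (auto simp: simple_graph_def)
  then obtain v where v: "v \<in> V" "v \<in> e" by (auto simp: card_2_iff)
  have "degree E v > 0" using e v(2) fin(2) unfolding degree_def by (auto simp: card_gt_0_iff)
  \<comment> \<open>An edge exists because \<open>k \<ge> 1\<close>, so the denominators below are
    positive.\<close>
  then have \<Delta>: "\<Delta> \<ge> 1" using deg[OF v(1)] by simp
  obtain VG :: "nat set" and EG where G: "simple_graph VG EG" "card EG = AR_s V E"
      "forces_rainbow VG EG V E"
  proof -
    have "\<exists>m. \<exists>(VG :: nat set) EG.
        simple_graph VG EG \<and> card EG = m \<and> forces_rainbow VG EG V E"
      using exists_forcing_graph[OF assms(1)] by blast
    from LeastI_ex[OF this] show thesis using that unfolding AR_s_def by blast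
  qed
  have "(k - 1)\<^sup>2 \<le> 2 * \<Delta> * AR_s V E"
    using forcing_card_ge[OF assms(1) deg \<Delta> G(1,3)] assms(2) G(2) by simp
  then have "real ((k - 1)\<^sup>2) \<le> real (2 * \<Delta> * AR_s V E)" by (rule of_nat_mono)
  \<comment> \<open>By \<open>k \<ge> 1\<close> the truncated difference \<open>k - 1\<close> agrees
    with the real one.\<close>
  then have "(real k - 1)\<^sup>2 / (2 * real \<Delta>) \<le> real (AR_s V E)"
    using \<Delta> assms(3) by (simp add: divide_le_eq of_nat_diff mult_ac)
  moreover have "real k * (real k + 1) / (2 * real \<Delta>) \<le> real (AR_s V E)"
    if \<chi>: "chromatic_index E = \<Delta>"
  proof -
    \<comment> \<open>Giving every edge its own color shows that the minimum in
      \<open>chromatic_index\<close> is attained.\<close>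
    obtain idx :: "'a set \<Rightarrow> nat" where "inj_on idx E"
      using finite_imp_inj_to_nat_seg[OF fin(2)] by blast
    then have "proper_edge_coloring E idx"
      by (auto simp: proper_edge_coloring_def dest: inj_onD)
    then have "\<exists>n. \<exists>c :: 'a set \<Rightarrow> nat. proper_edge_coloring E c \<and> card (c ` E) = n" by blast
    from LeastI_ex[OF this] obtain c :: "'a set \<Rightarrow> nat"
      where c: "proper_edge_coloring E c" "card (c ` E) = \<Delta>"
      using \<chi> unfolding chromatic_index_def by blast
    have "k * (k + 1) \<le> 2 * \<Delta> * AR_s V E"
      using forcing_card_ge_colorable[OF assms(1) c(1) _ G(1,3), of \<Delta>] assms(2) c(2) G(2) by simp
    then have "real (k * (k + 1)) \<le> real (2 * \<Delta> * AR_s V E)" by (rule of_nat_mono)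
    then show ?thesis using \<Delta> by (simp add: divide_le_eq algebra_simps)
  qed
  ultimately show ?thesis by blast
qed

end
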